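(* Assume that a reconstruction procedure $\mathrm{CWENO}(P_{\mathrm{opt}},P_1,\ldots,P_{\widehat m})$ satisfies Property R and that $\epsilon=\mathcal{O}(h)$ as $h\to0$. Suppose the reconstruction is applied to discontinuous data (a jump discontinuity is present in the stencil of $P_{\mathrm{opt}}$), but at least one of $I[P_1],\ldots,I[P_{\widehat m}]$ is of size $\mathcal{O}(h^2)$. Then $\omega_k\sim0$, i.e. $\omega_k\to0$ as $h\to0$, for every $k\in\{0,\ldots,\widehat m\}$ such that $I[P_k]\asymp1$.
   Context: Setting. A reconstruction is computed on a cell $\Omega$ of a grid, $h=\operatorname{diam}(\Omega)$, and asymptotics are for $h\to0$. The notation $f(h)\asymp g(h)$ (for $h\to0$) means that $\lim_{h\to0}f(h)/g(h)$ exists, is finite and not zero. The data are the cell averages of a known function $u$, and the mesh size is chosen so that at most one discontinuity is present in the stencil of $P_{\mathrm{opt}}$. $\mathbb{P}^n$ denotes the polynomials of degree at most $n$. $P_{\mathrm{opt}}\in\mathbb{P}^G$ interpolates (in the sense of cell averages) all data of the stencil, and $P_1,\ldots,P_{\widehat m}\in\mathbb{P}^g$, with $g<G$ and $\widehat m\ge1$, are lower degree polynomials interpolating the data on sub-stencils. Regularity indicator. $I$ is a regularity indicator, i.e. a nonnegative functional on polynomials measuring their smoothness on $\Omega$; the one employed is the Jiang-Shu indicator, in one dimension $$I[P]=\sum_{l\ge1}\operatorname{diam}(\Omega)^{2l-1}\int_\Omega\Big(\tfrac{\mathrm{d}^l}{\mathrm{d}x^l}P(x)\Big)^2\mathrm{d}x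 .$$ Definition of CWENO. Fix positive real linear coefficients $d_0,\ldots,d_{\widehat m}\in[0,1]$ with $\sum_{k=0}^{\widehat m}d_k=1$ (independent of $h$), an exponent $t\ge2$, and a small quantity $\epsilon>0$ (possibly depending on $h$). (1) Set $P_0(x)=\frac1{d_0}\Big(P_{\mathrm{opt}}(x)-\sum_{k=1}^{\widehat m}d_kP_k(x)\Big)\in\mathbb{P}^G$. (2) For $k=0,\ldots,\widehat m$ set $\alpha_k=\dfrac{d_k}{(I[P_k]+\epsilon)^t}$ and $\omega_k=\dfrac{\alpha_k}{\sum_{i=0}^{\widehat m}\alpha_i}$. (3) Set $P_{\mathrm{rec}}(x)=\sum_{k=0}^{\widehat m}\omega_kP_k(x)\in\mathbb{P}^G$; this is $\mathrm{CWENO}(P_{\mathrm{opt}},P_1,\ldots,P_{\widehat m})$. Property R. The reconstruction $\mathrm{CWENO}(P_{\mathrm{opt}},P_1,\ldots,P_{\widehat m})$ satisfies Property R if, whenever a jump discontinuity is present in the stencil, so that $I[P_{\mathrm{opt}}]\asymp1$ for $h\to0$, then also $I[P_0]\asymp1$. *)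

theory Defs
  imports "HOL-Analysis.Analysis" "HOL-Library.Landau_Symbols" "HOL-Computational_Algebra.Polynomial"
begin

definition same_order :: "(real \<Rightarrow> real) \<Rightarrow> (real \<Rightarrow> real) \<Rightarrow> bool"  (infix "\<asymp>" 50)
  where "f \<asymp> g \<longleftrightarrow> (\<exists>c. c \<noteq> 0 \<and> ((\<lambda>h. f h / g h) \<longlongrightarrow> c) (at_right 0))"

text \<open>
  A grid of the real line is given by its increasing sequence of nodes. Cells are numbered relative
  to the cell on which the reconstruction is computed, so that cell is always cell 0, and a stencil
  is a finite set of offsets that does not change under refinement.
\<close>

definition cell :: "(int \<Rightarrow> real) \<Rightarrow> int \<Rightarrow> real set"
  where "cell x j = {x j .. x (j + 1)}"

definition stencil_region :: "(int \<Rightarrow> real) \<Rightarrow> int set \<Rightarrow> real set"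
  where "stencil_region x S = (\<Union>j\<in>S. cell x j)"

definition grid_refinement :: "(real \<Rightarrow> int \<Rightarrow> real) \<Rightarrow> bool"
  where "grid_refinement grid \<longleftrightarrow>
    (\<forall>h>0. strict_mono (grid h) \<and> diameter (cell (grid h) 0) = h)"

definition cell_averages :: "(real \<Rightarrow> real) \<Rightarrow> (int \<Rightarrow> real) \<Rightarrow> int \<Rightarrow> real"
  where "cell_averages f x j = integral (cell x j) f / measure lborel (cell x j)"

definition interpolates :: "(int \<Rightarrow> real) \<Rightarrow> int set \<Rightarrow> (int \<Rightarrow> real) \<Rightarrow> real poly \<Rightarrow> bool"
  where "interpolates x S a p \<longleftrightarrow> (\<forall>j\<in>S. cell_averages (poly p) x j = a j)"

definition jump_discontinuity :: "(real \<Rightarrow> real) \<Rightarrow> real \<Rightarrow> bool"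
  where "jump_discontinuity u z \<longleftrightarrow>
    (\<exists>l r. l \<noteq> r \<and> (u \<longlongrightarrow> l) (at_left z) \<and> (u \<longlongrightarrow> r) (at_right z))"

text \<open>
  The jump has to lie in the interior of the region covered by the stencil (otherwise the cell
  averages do not see it), and it is the only discontinuity there.
\<close>

definition jump_in_stencil :: "(real \<Rightarrow> real) \<Rightarrow> (int \<Rightarrow> real) \<Rightarrow> int set \<Rightarrow> bool"
  where "jump_in_stencil u x S \<longleftrightarrow>
    (\<exists>z \<in> interior (stencil_region x S).
       jump_discontinuity u z \<and> continuous_on (stencil_region x S - {z}) u)"

definition discontinuous_data ::
    "(real \<Rightarrow> int \<Rightarrow> real) \<Rightarrow> int set \<Rightarrow> (real \<Rightarrow> real) \<Rightarrow> bool"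
  where "discontinuous_data grid S u \<longleftrightarrow>
    (\<forall>\<^sub>F h in at_right 0. jump_in_stencil u (grid h) S)"

text \<open>A regularity indicator takes the cell on which smoothness is measured and a polynomial.\<close>

definition regularity_indicator :: "(real set \<Rightarrow> real poly \<Rightarrow> real) \<Rightarrow> bool"
  where "regularity_indicator I \<longleftrightarrow> (\<forall>a b p. a < b \<longrightarrow> 0 \<le> I {a..b} p)"

text \<open>The sum over all orders of differentiation is finite, as those above the degree vanish.\<close>

definition jiang_shu :: "real set \<Rightarrow> real poly \<Rightarrow> real"
  where "jiang_shu \<Omega> p =
    (\<Sum>l = 1..degree p. diameter \<Omega> ^ (2 * l - 1) * integral \<Omega> (\<lambda>x. (poly ((pderiv ^^ l) p) x)\<^sup>2))"

lemma regularity_indicator_jiang_shu: "regularity_indicator jiang_shu"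
  unfolding regularity_indicator_def jiang_shu_def
  by (auto intro!: sum_nonneg mult_nonneg_nonneg integral_nonneg integrable_continuous_real
      continuous_intros zero_le_power[of "diameter _"] diameter_ge_0)

text \<open>
  The polynomials are functions of the grid nodes and of the cell averages; \<open>T k\<close> is the
  sub-stencil of \<open>P k\<close>.
\<close>

type_synonym interpolation = "(int \<Rightarrow> real) \<Rightarrow> (int \<Rightarrow> real) \<Rightarrow> real poly"

definition cweno_interpolants ::
    "int set \<Rightarrow> (nat \<Rightarrow> int set) \<Rightarrow> nat \<Rightarrow> nat \<Rightarrow> nat \<Rightarrow> interpolation \<Rightarrow> (nat \<Rightarrow> interpolation) \<Rightarrow> bool"
  where "cweno_interpolants S T G g m Popt P \<longleftrightarrow>
    1 \<le> m \<and> g < G \<and> finite S \<and> (\<forall>k\<in>{1..m}. T k \<subseteq> S) \<and>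
    (\<forall>x a. strict_mono x \<longrightarrow>
       degree (Popt x a) \<le> G \<and> interpolates x S a (Popt x a) \<and>
       (\<forall>k\<in>{1..m}. degree (P k x a) \<le> g \<and> interpolates x (T k) a (P k x a)))"

definition linear_coefficients :: "nat \<Rightarrow> (nat \<Rightarrow> real) \<Rightarrow> bool"
  where "linear_coefficients m d \<longleftrightarrow> (\<forall>k\<le>m. 0 < d k \<and> d k \<le> 1) \<and> (\<Sum>k\<le>m. d k) = 1"

definition interpolant ::
    "interpolation \<Rightarrow> (real \<Rightarrow> int \<Rightarrow> real) \<Rightarrow> (real \<Rightarrow> real) \<Rightarrow> real \<Rightarrow> real poly"
  where "interpolant F grid u h = F (grid h) (cell_averages u (grid h))"

text \<open>
  In the following definitions \<open>p k\<close>, for \<open>1 \<le> k \<le> m\<close>, are the low degree polynomials and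
  \<open>p 0\<close> is not used; \<open>ind\<close> is the regularity indicator on the cell under consideration.
\<close>

definition cweno_P0 :: "nat \<Rightarrow> (nat \<Rightarrow> real) \<Rightarrow> real poly \<Rightarrow> (nat \<Rightarrow> real poly) \<Rightarrow> real poly"
  where "cweno_P0 m d popt p = smult (1 / d 0) (popt - (\<Sum>k = 1..m. smult (d k) (p k)))"

definition cweno_poly ::
    "nat \<Rightarrow> (nat \<Rightarrow> real) \<Rightarrow> real poly \<Rightarrow> (nat \<Rightarrow> real poly) \<Rightarrow> nat \<Rightarrow> real poly"
  where "cweno_poly m d popt p k = (if k = 0 then cweno_P0 m d popt p else p k)"

definition cweno_alpha ::
    "(real poly \<Rightarrow> real) \<Rightarrow> real \<Rightarrow> real \<Rightarrow> nat \<Rightarrow> (nat \<Rightarrow> real) \<Rightarrow>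
     real poly \<Rightarrow> (nat \<Rightarrow> real poly) \<Rightarrow> nat \<Rightarrow> real"
  where "cweno_alpha ind t e m d popt p k = d k / (ind (cweno_poly m d popt p k) + e) powr t"

definition cweno_weight ::
    "(real poly \<Rightarrow> real) \<Rightarrow> real \<Rightarrow> real \<Rightarrow> nat \<Rightarrow> (nat \<Rightarrow> real) \<Rightarrow>
     real poly \<Rightarrow> (nat \<Rightarrow> real poly) \<Rightarrow> nat \<Rightarrow> real"
  where "cweno_weight ind t e m d popt p k =
    cweno_alpha ind t e m d popt p k / (\<Sum>i\<le>m. cweno_alpha ind t e m d popt p i)"

definition cweno ::
    "(real poly \<Rightarrow> real) \<Rightarrow> real \<Rightarrow> real \<Rightarrow> nat \<Rightarrow> (nat \<Rightarrow> real) \<Rightarrow>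
     real poly \<Rightarrow> (nat \<Rightarrow> real poly) \<Rightarrow> real poly"
  where "cweno ind t e m d popt p =
    (\<Sum>k\<le>m. smult (cweno_weight ind t e m d popt p k) (cweno_poly m d popt p k))"

text \<open>
  Property R, for the reconstruction on a given family of grids: for all data with a jump in the
  stencil for which the indicator of the optimal polynomial is of order one.
\<close>

definition property_R ::
    "(real set \<Rightarrow> real poly \<Rightarrow> real) \<Rightarrow> (real \<Rightarrow> int \<Rightarrow> real) \<Rightarrow> int set \<Rightarrow> nat \<Rightarrow> (nat \<Rightarrow> real) \<Rightarrow>
     interpolation \<Rightarrow> (nat \<Rightarrow> interpolation) \<Rightarrow> bool"
  where "property_R I grid S m d Popt P \<longleftrightarrow>
    (\<forall>u. discontinuous_data grid S u \<and>
       (\<lambda>h. I (cell (grid h) 0) (interpolant Popt grid u h)) \<asymp> (\<lambda>h. 1) \<longrightarrow>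
       (\<lambda>h. I (cell (grid h) 0)
              (cweno_P0 m d (interpolant Popt grid u h) (\<lambda>k. interpolant (P k) grid u h)))
         \<asymp> (\<lambda>h. 1))"

end

theory Submission
  imports Defs
begin

text \<open>
  Up to the fixed factor \<open>d k / d j\<close>, the quotient of two nonlinear weights \<open>\<omega>\<^sub>k / \<omega>\<^sub>j\<close>
  is the power \<open>((I[P\<^sub>j] + \<epsilon>) / (I[P\<^sub>k] + \<epsilon>)) powr t\<close>. If \<open>P\<^sub>j\<close> is the smooth polynomial,
  the numerator of this base is \<open>O(h\<^sup>2) + O(h)\<close> and tends to zero; if \<open>I[P\<^sub>k] \<asymp> 1\<close>, the
  denominator tends to a positive number, because the indicator is nonnegative. Hence the quotient
  tends to zero, and so does \<open>\<omega>\<^sub>k\<close>, because \<open>\<omega>\<^sub>j \<le> 1\<close>.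

  The two steps of the argument are
  \<open>cweno_weight_le_quotient\<close> (the bound) and \<open>cweno_weight_tendsto_0\<close> (the limit).
\<close>

lemma cweno_alpha_pos:
  assumes "0 < d k" and "0 \<le> ind (cweno_poly m d popt p k)" and "0 < e"
  shows "0 < cweno_alpha ind t e m d popt p k"
  using assms by (simp add: cweno_alpha_def)

lemma cweno_weight_nonneg:
  assumes "\<And>i. i \<le> m \<Longrightarrow> 0 < d i" and "\<And>i. i \<le> m \<Longrightarrow> 0 \<le> ind (cweno_poly m d popt p i)"
    and "0 < e" and "k \<le> m"
  shows "0 \<le> cweno_weight ind t e m d popt p k"
  unfolding cweno_weight_def
  by (intro divide_nonneg_nonneg sum_nonneg less_imp_le[OF cweno_alpha_pos] assms) (use assms in auto)

text \<open>
  The sum in the denominator of the weight \<open>k\<close> is at least its term \<open>j\<close>: this is the inequality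
  \<open>\<omega>\<^sub>j \<le> 1\<close> in the form in which it is used.
\<close>

lemma cweno_weight_le_quotient:
  assumes d: "\<And>i. i \<le> m \<Longrightarrow> 0 < d i"
    and ind: "\<And>i. i \<le> m \<Longrightarrow> 0 \<le> ind (cweno_poly m d popt p i)"
    and "0 < e" and "k \<le> m" and "j \<le> m"
  shows "cweno_weight ind t e m d popt p k \<le>
    d k / d j * ((ind (cweno_poly m d popt p j) + e) / (ind (cweno_poly m d popt p k) + e)) powr t"
proof -
  let ?\<alpha> = "cweno_alpha ind t e m d popt p"
  have pos: "0 < ?\<alpha> i" if "i \<le> m" for i
    using that d ind \<open>0 < e\<close> by (intro cweno_alpha_pos)
  have "?\<alpha> j \<le> (\<Sum>i\<le>m. ?\<alpha> i)"
    using \<open>j \<le> m\<close> by (intro member_le_sum) (auto intro: less_imp_le[OF pos])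
  then have "cweno_weight ind t e m d popt p k \<le> ?\<alpha> k / ?\<alpha> j"
    unfolding cweno_weight_def using pos[OF \<open>k \<le> m\<close>] pos[OF \<open>j \<le> m\<close>]
    by (intro divide_left_mono) auto
  also have "?\<alpha> k / ?\<alpha> j =
      d k / d j * ((ind (cweno_poly m d popt p j) + e) / (ind (cweno_poly m d popt p k) + e)) powr t"
    using ind[OF \<open>j \<le> m\<close>] ind[OF \<open>k \<le> m\<close>] \<open>0 < e\<close>
    by (simp add: cweno_alpha_def powr_divide)
  finally show ?thesis .
qed

text \<open>
  One smooth polynomial \<open>j\<close> drives the weight of each polynomial with a nonvanishing limit
  indicator to zero. The exponent has to be positive: then the power is continuous at the limit 0
  of its base.
\<close>

lemma cweno_weight_tendsto_0:
  fixes ind :: "'a \<Rightarrow> real poly \<Rightarrow> real" and F :: "'a filter"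
  assumes d: "\<And>i. i \<le> m \<Longrightarrow> 0 < d i" and "0 < t" and k: "k \<le> m" and j: "j \<le> m"
    and ind: "\<forall>\<^sub>F h in F. \<forall>i\<le>m. 0 \<le> ind h (cweno_poly m d (popt h) (p h) i)"
    and e_pos: "\<forall>\<^sub>F h in F. 0 < e h" and e: "(e \<longlongrightarrow> 0) F"
    and smooth: "((\<lambda>h. ind h (cweno_poly m d (popt h) (p h) j)) \<longlongrightarrow> 0) F"
    and rough: "((\<lambda>h. ind h (cweno_poly m d (popt h) (p h) k)) \<longlongrightarrow> c) F" and "c \<noteq> 0"
  shows "((\<lambda>h. cweno_weight (ind h) t (e h) m d (popt h) (p h) k) \<longlongrightarrow> 0) F"
proof (rule tendsto_sandwich)
  let ?I = "\<lambda>i h. ind h (cweno_poly m d (popt h) (p h) i)"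
  let ?q = "\<lambda>h. (?I j h + e h) / (?I k h + e h)"
  show "\<forall>\<^sub>F h in F. 0 \<le> cweno_weight (ind h) t (e h) m d (popt h) (p h) k"
    using ind e_pos by eventually_elim (use d k in \<open>auto intro!: cweno_weight_nonneg\<close>)
  show "\<forall>\<^sub>F h in F. cweno_weight (ind h) t (e h) m d (popt h) (p h) k \<le> d k / d j * ?q h powr t"
    using ind e_pos by eventually_elim (use d k j in \<open>intro cweno_weight_le_quotient; simp\<close>)
  have "(?q \<longlongrightarrow> (0 + 0) / (c + 0)) F"
    using \<open>c \<noteq> 0\<close> by (intro tendsto_intros smooth rough e) simp
  then have q: "(?q \<longlongrightarrow> 0) F" by simp
  have "\<forall>\<^sub>F h in F. 0 \<le> ?q h"
    using ind e_pos by eventually_elim (use k j in \<open>auto intro!: divide_nonneg_nonneg add_nonneg_nonneg\<close>)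
  with q have "((\<lambda>h. ?q h powr t) \<longlongrightarrow> 0 powr t) F"
    using \<open>0 < t\<close> by (intro tendsto_powr' tendsto_const) auto
  then show "((\<lambda>h. d k / d j * ?q h powr t) \<longlongrightarrow> 0) F"
    using \<open>0 < t\<close> by (intro tendsto_mult_right_zero) simp
qed simp

lemma bigo_tendsto_0:
  fixes f g :: "'a \<Rightarrow> real"
  assumes "f \<in> O[F](g)" and g: "(g \<longlongrightarrow> 0) F"
  shows "(f \<longlongrightarrow> 0) F"
proof -
  obtain C where "\<forall>\<^sub>F x in F. norm (f x) \<le> C * norm (g x)"
    using assms(1) by (auto simp: bigo_def)
  moreover have "((\<lambda>x. C * norm (g x)) \<longlongrightarrow> 0) F"
    using tendsto_norm_zero[OF g] by (rule tendsto_mult_right_zero)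
  ultimately show ?thesis
    by (rule Lim_null_comparison)
qed

theorem theorem1:
  fixes I :: "real set \<Rightarrow> real poly \<Rightarrow> real"
    and grid :: "real \<Rightarrow> int \<Rightarrow> real"
    and S :: "int set" and T :: "nat \<Rightarrow> int set"
    and G g m :: nat
    and Popt :: interpolation and P :: "nat \<Rightarrow> interpolation"
    and d :: "nat \<Rightarrow> real" and t :: real and \<epsilon> :: "real \<Rightarrow> real"
    and u :: "real \<Rightarrow> real"
  assumes "regularity_indicator I"
    and "grid_refinement grid"
    and "cweno_interpolants S T G g m Popt P"
    and "linear_coefficients m d"
    and "2 \<le> t"
    and "\<And>h. 0 < h \<Longrightarrow> 0 < \<epsilon> h"
    and "\<epsilon> \<in> O[at_right 0](\<lambda>h. h)"
    and "property_R I grid S m d Popt P"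
    and "discontinuous_data grid S u"
    and "\<exists>j\<in>{1..m}. (\<lambda>h. I (cell (grid h) 0) (interpolant (P j) grid u h)) \<in> O[at_right 0](\<lambda>h. h\<^sup>2)"
  shows "\<forall>k\<le>m.
    (\<lambda>h. I (cell (grid h) 0)
           (cweno_poly m d (interpolant Popt grid u h) (\<lambda>i. interpolant (P i) grid u h) k))
      \<asymp> (\<lambda>h. 1) \<longrightarrow>
    ((\<lambda>h. cweno_weight (I (cell (grid h) 0)) t (\<epsilon> h) m d
            (interpolant Popt grid u h) (\<lambda>i. interpolant (P i) grid u h) k) \<longlongrightarrow> 0) (at_right 0)"
proof (intro allI impI)
  let ?F = "at_right (0 :: real)"
  let ?Q = "\<lambda>h. cweno_poly m d (interpolant Popt grid u h) (\<lambda>i. interpolant (P i) grid u h)"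
  fix k
  assume k: "k \<le> m" and "(\<lambda>h. I (cell (grid h) 0) (?Q h k)) \<asymp> (\<lambda>h. 1)"
  then obtain c where "c \<noteq> 0" and rough: "((\<lambda>h. I (cell (grid h) 0) (?Q h k)) \<longlongrightarrow> c) ?F"
    by (auto simp: same_order_def)
  obtain j where "j \<in> {1..m}"
    and Ij: "(\<lambda>h. I (cell (grid h) 0) (interpolant (P j) grid u h)) \<in> O[?F](\<lambda>h. h\<^sup>2)"
    using assms(10) by blast
  then have j: "j \<le> m" and Qj: "?Q h j = interpolant (P j) grid u h" for h
    by (auto simp: cweno_poly_def)
  have pos: "\<forall>\<^sub>F h in ?F. 0 < h"
    by (rule eventually_at_right_less)
  have smooth: "((\<lambda>h. I (cell (grid h) 0) (?Q h j)) \<longlongrightarrow> 0) ?F"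
    unfolding Qj by (rule bigo_tendsto_0[OF Ij]) (auto intro!: tendsto_eq_intros)
  have e: "(\<epsilon> \<longlongrightarrow> 0) ?F"
    by (rule bigo_tendsto_0[OF assms(7)]) (auto intro!: tendsto_eq_intros)
  have ind: "\<forall>\<^sub>F h in ?F. \<forall>i\<le>m. 0 \<le> I (cell (grid h) 0) (?Q h i)"
    using pos
  proof eventually_elim
    case (elim h)
    \<comment> \<open>Nonnegativity of the indicator is known on nondegenerate intervals, so the cell must be one.\<close>
    then have "grid h 0 < grid h (0 + 1)"
      using assms(2) by (simp add: grid_refinement_def strict_mono_def)
    then show ?case
      using assms(1) unfolding regularity_indicator_def cell_def by blast
  qed
  show "((\<lambda>h. cweno_weight (I (cell (grid h) 0)) t (\<epsilon> h) m d
      (interpolant Popt grid u h) (\<lambda>i. interpolant (P i) grid u h) k) \<longlongrightarrow> 0) ?F"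
  proof (rule cweno_weight_tendsto_0[OF _ _ k j ind _ e smooth rough \<open>c \<noteq> 0\<close>])
    show "0 < d i" if "i \<le> m" for i
      using that assms(4) by (simp add: linear_coefficients_def)
    show "\<forall>\<^sub>F h in ?F. 0 < \<epsilon> h"
      using pos by eventually_elim (rule assms(6))
  qed (use assms(5) in simp)
qed

end
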